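(* Suppose $\hat\mu$ is a weak tangent measure to a locally finite Borel measure $\mu$ on $\mathbb{R}^d$. Then \[ \overline{\dim}_{\mathrm{reg}}\,\hat\mu\ \le\ \overline{\dim}_{\mathrm{reg}}\,\mu . \]
   Context: $B(x,r)$ denotes the open ball of centre $x$ and radius $r$, and $\mathrm{supp}(\mu)$ is the support of $\mu$. Upper regularity dimension: for a locally finite Borel measure $\mu$ on a metric space, $\overline{\dim}_{\mathrm{reg}}\,\mu$ is the infimum of all $s\ge 0$ for which there is a constant $C>0$ such that for all $0<r<R$ and all $x\in\mathrm{supp}(\mu)$, $\frac{\mu(B(x,R))}{\mu(B(x,r))}\le C\left(\frac{R}{r}\right)^s$ (with $\inf\emptyset=+\infty$). A map $T:\mathbb{R}^d\to\mathbb{R}^d$ is a similarity if there is a constant $c\in(0,1)$ (the similarity ratio) with $|T(x)-T(y)|=c|x-y|$ for all $x,y\in\mathbb{R}^d$. A (locally finite) Borel measure $\hat\mu$ on $\mathbb{R}^d$ is a weak tangent measure to a locally finite Borel measure $\mu$ on $\mathbb{R}^d$ if there exist a sequence of similarity maps $T_k$ on $\mathbb{R}^d$ and a sequence of positive renormalising numbers $p_k$ such that $p_k\,\mu\circ T_k^{-1}\rightharpoonup\hat\mu$, where $\rightharpoonup$ denotes weak convergence of locally finite Borel measures on $\mathbb{R}^d$, i.e. $\int\varphi\,d(p_k\,\mu\circ T_k^{-1})\to\int\varphi\,d\hat\mu$ for every continuous compactly supported $\varphi:\mathbb{R}^d\to\mathbb{R}$. *)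

theory Defs
  imports "HOL-Analysis.Analysis"
begin

definition locally_finite_borel_measure :: "'a::topological_space measure \<Rightarrow> bool" where
  "locally_finite_borel_measure \<mu> \<longleftrightarrow>
     sets \<mu> = sets borel \<and> (\<forall>x. \<exists>U. open U \<and> x \<in> U \<and> emeasure \<mu> U < \<infinity>)"

definition measure_supp :: "'a::topological_space measure \<Rightarrow> 'a set" where
  "measure_supp \<mu> = {x. \<forall>U. open U \<and> x \<in> U \<longrightarrow> emeasure \<mu> U > 0}"

(* The quotient is taken in ennreal; its denominator is positive because x lies in the support.
   The infimum is taken in ereal, where Inf {} = \<infinity>. *)
definition upper_reg_dim :: "'a::metric_space measure \<Rightarrow> ereal" where
  "upper_reg_dim \<mu> =
     (INF s \<in> {s::real. 0 \<le> s \<and>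
        (\<exists>C::real. C > 0 \<and>
          (\<forall>r R::real. 0 < r \<and> r < R \<longrightarrow>
            (\<forall>x \<in> measure_supp \<mu>.
               emeasure \<mu> (ball x R) / emeasure \<mu> (ball x r) \<le> ennreal (C * (R / r) powr s))))}.
      ereal s)"

definition similarity :: "('a::metric_space \<Rightarrow> 'a) \<Rightarrow> bool" where
  "similarity T \<longleftrightarrow> (\<exists>c::real. 0 < c \<and> c < 1 \<and> (\<forall>x y. dist (T x) (T y) = c * dist x y))"

(* Convergence against continuous compactly supported test functions. *)
definition weakly_converges ::
    "(nat \<Rightarrow> 'a::topological_space measure) \<Rightarrow> 'a measure \<Rightarrow> bool" where
  "weakly_converges \<nu> \<mu> \<longleftrightarrow>
     (\<forall>\<phi> :: 'a \<Rightarrow> real. continuous_on UNIV \<phi> \<and> compact (closure {x. \<phi> x \<noteq> 0}) \<longrightarrow>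
        (\<lambda>k. integral\<^sup>L (\<nu> k) \<phi>) \<longlonglongrightarrow> integral\<^sup>L \<mu> \<phi>)"

definition weak_tangent_measure :: "'a::metric_space measure \<Rightarrow> 'a measure \<Rightarrow> bool" where
  "weak_tangent_measure \<mu>' \<mu> \<longleftrightarrow>
     locally_finite_borel_measure \<mu>' \<and>
     (\<exists>(T :: nat \<Rightarrow> 'a \<Rightarrow> 'a) (p :: nat \<Rightarrow> real).
        (\<forall>k. similarity (T k)) \<and> (\<forall>k. p k > 0) \<and>
        weakly_converges (\<lambda>k. scale_measure (ennreal (p k)) (distr \<mu> borel (T k))) \<mu>')"

end

theory Submission
  imports Defs
begin

text \<open>
  A bound \<open>\<nu> (ball x R) \<le> C * (R / r) powr s * \<nu> (ball x r)\<close> is scale invariant: a similarity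
  carries balls to balls and multiplies both radii by the same number, and the renormalising
  constant multiplies both measures. Hence every measure in the sequence defining a weak tangent
  satisfies the bound of \<open>\<mu>\<close> with the same \<open>C\<close> and \<open>s\<close>, at the images under the similarity of the
  points of the support of \<open>\<mu>\<close> (\<open>homogeneous_on_similar_image\<close>).

  The bound survives the weak limit up to a factor depending on \<open>s\<close> only
  (\<open>homogeneous_on_weak_limit\<close>). A point \<open>x\<close> in the support of the limit is approximated by points
  \<open>y\<close> at which the approximating measures satisfy the bound. Balls around \<open>x\<close> and \<open>y\<close> are comparable
  after changing radii by a bounded factor, and so are ball masses and integrals of continuous
  cutoff functions, which converge. Therefore each exponent admissible for \<open>\<mu>\<close> is admissible for
  the weak tangent, and the infimum can only decrease.
\<close>

section \<open>Locally finite measures and their supports\<close>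

lemma bounded_emeasure_finite:
  fixes \<nu> :: "'a::heine_borel measure"
  assumes lf: "locally_finite_borel_measure \<nu>" and "bounded S"
  shows "emeasure \<nu> S < \<infinity>"
proof -
  have sets [simp]: "sets \<nu> = sets borel"
    using lf by (simp add: locally_finite_borel_measure_def)
  define \<U> where "\<U> = {U. open U \<and> emeasure \<nu> U < \<infinity>}"
  have "compact (closure S)"
    using \<open>bounded S\<close> by (simp add: compact_closure)
  moreover have "closure S \<subseteq> \<Union>\<U>"
  proof
    fix x
    obtain U where "open U" "x \<in> U" "emeasure \<nu> U < \<infinity>"
      using lf unfolding locally_finite_borel_measure_def by blast
    then show "x \<in> \<Union>\<U>"
      by (auto simp: \<U>_def)
  qed
  ultimately obtain \<F> where \<F>: "\<F> \<subseteq> \<U>" "finite \<F>" "closure S \<subseteq> \<Union>\<F>"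
    by (rule compactE) (auto simp: \<U>_def)
  have meas: "\<F> \<subseteq> sets \<nu>"
    using \<F>(1) by (auto simp: \<U>_def)
  have "emeasure \<nu> S \<le> emeasure \<nu> (\<Union>\<F>)"
    using \<F>(3) closure_subset[of S] meas \<F>(2)
    by (intro emeasure_mono) auto
  also have "\<dots> \<le> (\<Sum>U\<in>\<F>. emeasure \<nu> U)"
    using emeasure_subadditive_finite[of \<F> "\<lambda>U. U" \<nu>] meas \<F>(2) by simp
  also have "\<dots> < \<infinity>"
    using \<F>(1,2) by (auto simp: \<U>_def ennreal_sum_less_top less_top)
  finally show ?thesis .
qed

lemma bounded_emeasure_eq_measure:
  fixes \<nu> :: "'a::heine_borel measure"
  assumes "locally_finite_borel_measure \<nu>" and "bounded S"
  shows "emeasure \<nu> S = ennreal (measure \<nu> S)"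
  using bounded_emeasure_finite[OF assms] by (simp add: emeasure_eq_ennreal_measure)

lemma measure_mono_bounded:
  fixes \<nu> :: "'a::heine_borel measure"
  assumes lf: "locally_finite_borel_measure \<nu>"
    and "A \<subseteq> B" "bounded B" "A \<in> sets borel" "B \<in> sets borel"
  shows "measure \<nu> A \<le> measure \<nu> B"
proof (rule measure_mono_fmeasurable)
  show "A \<in> sets \<nu>" "B \<in> fmeasurable \<nu>"
    using assms bounded_emeasure_finite[OF lf]
    by (auto simp: locally_finite_borel_measure_def fmeasurable_def)
qed fact

text \<open>
  Every point off the support has a null neighbourhood, and by second countability countably many
  of these cover the complement of the support.
\<close>

lemma open_meets_measure_supp:
  fixes \<mu> :: "'a::second_countable_topology measure"
  assumes sets: "sets \<mu> = sets borel" and "open U" "emeasure \<mu> U > 0"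
  shows "U \<inter> measure_supp \<mu> \<noteq> {}"
proof
  assume empty: "U \<inter> measure_supp \<mu> = {}"
  define \<N> where "\<N> = {V. open V \<and> emeasure \<mu> V = 0}"
  obtain \<C> where \<C>: "\<C> \<subseteq> \<N>" "countable \<C>" "\<Union>\<C> = \<Union>\<N>"
    using Lindelof[of \<N>] by (auto simp: \<N>_def)
  have "U \<subseteq> \<Union>\<N>"
    using empty unfolding \<N>_def measure_supp_def by (auto simp: zero_less_iff_neq_zero)
  moreover have "(\<Union>V\<in>\<C>. V) \<in> null_sets \<mu>"
    using \<C>(1,2) sets by (intro null_sets_UN') (auto simp: \<N>_def null_sets_def)
  ultimately have "emeasure \<mu> U \<le> 0"
    using emeasure_mono[of U "\<Union>\<C>" \<mu>] \<C>(3) by (auto simp: null_sets_def)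
  with assms(3) show False by simp
qed

section \<open>Cutoff functions\<close>

definition cutoff :: "'a::metric_space \<Rightarrow> real \<Rightarrow> real \<Rightarrow> 'a \<Rightarrow> real" where
  "cutoff x a b = (\<lambda>y. max 0 (min 1 ((b - dist x y) / (b - a))))"

lemma continuous_cutoff: "continuous_on UNIV (cutoff x a b)"
proof (cases "a = b")
  case True
  then show ?thesis by (simp add: cutoff_def)
next
  case False
  then show ?thesis
    unfolding cutoff_def by (auto intro!: continuous_intros)
qed

lemma cutoff_bounds:
  assumes "a < b"
  shows "indicator (ball x a) y \<le> cutoff x a b y" "cutoff x a b y \<le> indicator (ball x b) y"
  using assms by (auto simp: cutoff_def indicator_def field_simps)

lemma compact_support_cutoff:
  fixes x :: "'a::heine_borel"
  assumes "a < b"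
  shows "compact (closure {y. cutoff x a b y \<noteq> 0})"
proof -
  have "{y. cutoff x a b y \<noteq> 0} \<subseteq> ball x b"
  proof
    fix y assume "y \<in> {y. cutoff x a b y \<noteq> 0}"
    moreover have "cutoff x a b y \<ge> 0"
      by (simp add: cutoff_def)
    ultimately show "y \<in> ball x b"
      using cutoff_bounds(2)[OF assms, of x y] by (cases "y \<in> ball x b") auto
  qed
  then show ?thesis
    using bounded_subset[OF bounded_ball] by (auto simp: compact_closure)
qed

lemma integral_cutoff_bounds:
  fixes \<nu> :: "'a::heine_borel measure"
  assumes lf: "locally_finite_borel_measure \<nu>" and "a < b"
  shows "measure \<nu> (ball x a) \<le> (\<integral>y. cutoff x a b y \<partial>\<nu>)"
    and "(\<integral>y. cutoff x a b y \<partial>\<nu>) \<le> measure \<nu> (ball x b)"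
proof -
  have sets: "sets \<nu> = sets borel"
    using lf by (simp add: locally_finite_borel_measure_def)
  have ind: "integrable \<nu> (indicator (ball x c) :: 'a \<Rightarrow> real)" for c
    using bounded_emeasure_finite[OF lf bounded_ball] sets
    by (intro integrable_real_indicator) auto
  have "cutoff x a b \<in> borel_measurable borel"
    by (intro borel_measurable_continuous_onI continuous_cutoff)
  then have meas: "cutoff x a b \<in> borel_measurable \<nu>"
    using measurable_cong_sets[OF sets refl] by blast
  have int: "integrable \<nu> (cutoff x a b)"
    by (rule Bochner_Integration.integrable_bound[OF ind[of b] meas])
      (use cutoff_bounds(2)[OF \<open>a < b\<close>, of x] in \<open>auto simp: cutoff_def indicator_def\<close>)
  have [simp]: "space \<nu> = UNIV"
    using sets_eq_imp_space_eq[OF sets] by simp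
  have m: "(\<integral>y. indicator (ball x c) y \<partial>\<nu>) = measure \<nu> (ball x c)" for c
    by simp
  show "measure \<nu> (ball x a) \<le> (\<integral>y. cutoff x a b y \<partial>\<nu>)"
    unfolding m[symmetric] by (intro integral_mono ind int cutoff_bounds \<open>a < b\<close>)
  show "(\<integral>y. cutoff x a b y \<partial>\<nu>) \<le> measure \<nu> (ball x b)"
    unfolding m[symmetric] by (intro integral_mono ind int cutoff_bounds \<open>a < b\<close>)
qed

section \<open>Homogeneity and its invariance under similarities\<close>

text \<open>
  The set of centres is a parameter because, for the image of \<open>\<mu>\<close> under a similarity \<open>T\<close>, the natural
  centres are \<open>T ` measure_supp \<mu>\<close>; this avoids identifying this set with the support of the image.
\<close>

definition homogeneous_on :: "'a::metric_space set \<Rightarrow> 'a measure \<Rightarrow> real \<Rightarrow> real \<Rightarrow> bool" where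
  "homogeneous_on A \<nu> C s \<longleftrightarrow>
     (\<forall>x\<in>A. \<forall>r R. 0 < r \<and> r < R \<longrightarrow>
        measure \<nu> (ball x R) \<le> C * (R / r) powr s * measure \<nu> (ball x r))"

lemma measure_ball_pos:
  fixes \<mu> :: "'a::heine_borel measure"
  assumes "locally_finite_borel_measure \<mu>" "x \<in> measure_supp \<mu>" "r > 0"
  shows "measure \<mu> (ball x r) > 0"
proof -
  have "emeasure \<mu> (ball x r) > 0"
    using assms(2,3) by (simp add: measure_supp_def)
  then show ?thesis
    by (simp add: bounded_emeasure_eq_measure[OF assms(1) bounded_ball])
qed

lemma homogeneous_on_measure_supp_iff:
  fixes \<mu> :: "'a::heine_borel measure"
  assumes lf: "locally_finite_borel_measure \<mu>" and "C > 0"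
  shows "homogeneous_on (measure_supp \<mu>) \<mu> C s \<longleftrightarrow>
    (\<forall>r R. 0 < r \<and> r < R \<longrightarrow> (\<forall>x\<in>measure_supp \<mu>.
       emeasure \<mu> (ball x R) / emeasure \<mu> (ball x r) \<le> ennreal (C * (R / r) powr s)))"
proof -
  have "emeasure \<mu> (ball x R) / emeasure \<mu> (ball x r) \<le> ennreal (C * (R / r) powr s) \<longleftrightarrow>
      measure \<mu> (ball x R) \<le> C * (R / r) powr s * measure \<mu> (ball x r)"
    if "x \<in> measure_supp \<mu>" "0 < r" for x r R
    using measure_ball_pos[OF lf that] \<open>C > 0\<close>
    by (simp add: bounded_emeasure_eq_measure[OF lf bounded_ball] divide_ennreal
        pos_divide_le_eq)
  then show ?thesis
    unfolding homogeneous_on_def by blast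
qed

lemma similarity_vimage_ball:
  fixes T :: "'a::metric_space \<Rightarrow> 'a"
  assumes "c > 0" and "\<And>x y. dist (T x) (T y) = c * dist x y"
  shows "T -` ball (T z) r = ball z (r / c)"
  using assms by (auto simp: field_simps)

lemma continuous_similarity:
  assumes "\<And>x y. dist (T x) (T y) = c * dist x y"
  shows "continuous_on UNIV T"
proof (rule lipschitz_on_continuous_on)
  show "\<bar>c\<bar>-lipschitz_on UNIV T"
    by (intro lipschitz_onI) (simp_all add: assms mult_right_mono)
qed

text \<open>
  Preimages of bounded sets under a similarity are bounded, so the image measure puts finite mass
  on balls.
\<close>

lemma locally_finite_similar_image:
  fixes T :: "'a::heine_borel \<Rightarrow> 'a"
  assumes lf: "locally_finite_borel_measure \<mu>" and "similarity T"
  shows "locally_finite_borel_measure (scale_measure (ennreal p) (distr \<mu> borel T))"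
  unfolding locally_finite_borel_measure_def
proof (intro conjI allI)
  fix x
  obtain c where c: "c > 0" "\<And>x y. dist (T x) (T y) = c * dist x y"
    using \<open>similarity T\<close> by (auto simp: similarity_def)
  have sets: "sets \<mu> = sets borel"
    using lf by (simp add: locally_finite_borel_measure_def)
  then have [simp]: "space \<mu> = UNIV"
    using sets_eq_imp_space_eq[OF sets] by simp
  have meas: "T \<in> measurable \<mu> borel"
    using borel_measurable_continuous_onI[OF continuous_similarity[of T c]] c(2)
      measurable_cong_sets[OF sets refl] by blast
  have "bounded (T -` ball x 1)"
  proof -
    have "dist z w \<le> 2 / c" if "T z \<in> ball x 1" "T w \<in> ball x 1" for z w
    proof -
      have "c * dist z w \<le> 2"
        using that dist_triangle3[of "T z" "T w" x] c(2)[of z w] by simp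
      then show ?thesis
        using c(1) by (simp add: field_simps)
    qed
    then show ?thesis
      unfolding bounded_two_points by (intro exI[of _ "2 / c"]) simp
  qed
  then have "emeasure \<mu> (T -` ball x 1) < \<infinity>"
    by (rule bounded_emeasure_finite[OF lf])
  then have "emeasure (scale_measure (ennreal p) (distr \<mu> borel T)) (ball x 1) < \<infinity>"
    by (simp add: emeasure_distr[OF meas] ennreal_mult_less_top)
  then show "\<exists>U. open U \<and> x \<in> U \<and>
      emeasure (scale_measure (ennreal p) (distr \<mu> borel T)) U < \<infinity>"
    by (intro exI[of _ "ball x 1"]) auto
qed simp

text \<open>
  The image measure gives the ball of radius \<open>q\<close> about \<open>T z\<close> the mass \<open>p * \<mu> (ball z (q / c))\<close>,
  where \<open>c\<close> is the ratio of \<open>T\<close>; both \<open>p\<close> and \<open>c\<close> cancel in the inequality.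
\<close>

lemma homogeneous_on_similar_image:
  fixes T :: "'a::heine_borel \<Rightarrow> 'a"
  assumes lf: "locally_finite_borel_measure \<mu>" and "similarity T" and "p > 0"
    and hom: "homogeneous_on A \<mu> C s"
  shows "homogeneous_on (T ` A) (scale_measure (ennreal p) (distr \<mu> borel T)) C s"
  unfolding homogeneous_on_def
proof (clarsimp)
  fix z and r R :: real
  assume z: "z \<in> A" and r: "0 < r" "r < R"
  obtain c where c: "c > 0" "\<And>x y. dist (T x) (T y) = c * dist x y"
    using \<open>similarity T\<close> by (auto simp: similarity_def)
  have sets: "sets \<mu> = sets borel"
    using lf by (simp add: locally_finite_borel_measure_def)
  then have [simp]: "space \<mu> = UNIV"
    using sets_eq_imp_space_eq[OF sets] by simp
  have meas: "T \<in> measurable \<mu> borel"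
    using borel_measurable_continuous_onI[OF continuous_similarity[of T c]] c(2)
      measurable_cong_sets[OF sets refl] by blast
  have ball: "measure (scale_measure (ennreal p) (distr \<mu> borel T)) (ball (T z) q)
      = p * measure \<mu> (ball z (q / c))" for q
    using \<open>p > 0\<close>
    by (simp add: measure_scale_measure measure_distr[OF meas] similarity_vimage_ball[of c T, OF c])
  have "measure \<mu> (ball z (R / c)) \<le> C * ((R / c) / (r / c)) powr s * measure \<mu> (ball z (r / c))"
    using hom[unfolded homogeneous_on_def, rule_format, OF z, of "r / c" "R / c"] r c(1)
    by (simp add: divide_strict_right_mono)
  moreover have "(R / c) / (r / c) = R / r"
    using c(1) by simp
  ultimately have "measure \<mu> (ball z (R / c)) \<le> C * (R / r) powr s * measure \<mu> (ball z (r / c))"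
    by (simp only:)
  then show "measure (scale_measure (ennreal p) (distr \<mu> borel T)) (ball (T z) R)
      \<le> C * (R / r) powr s * measure (scale_measure (ennreal p) (distr \<mu> borel T)) (ball (T z) r)"
    using \<open>p > 0\<close> unfolding ball by (simp add: mult.left_commute)
qed

text \<open>
  This provides the centres \<open>y\<close> near a point of the support of the weak limit: each ball around such
  a point has positive mass for the approximating measures far enough along the sequence.
\<close>

lemma similar_image_charges:
  fixes T :: "'a::{heine_borel, second_countable_topology} \<Rightarrow> 'a"
  assumes lf: "locally_finite_borel_measure \<mu>" and "similarity T"
    and "open U" and pos: "emeasure (scale_measure (ennreal p) (distr \<mu> borel T)) U > 0"
  shows "U \<inter> T ` measure_supp \<mu> \<noteq> {}"
proof -
  have cont: "continuous_on UNIV T"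
    using \<open>similarity T\<close> continuous_similarity by (auto simp: similarity_def)
  have sets: "sets \<mu> = sets borel"
    using lf by (simp add: locally_finite_borel_measure_def)
  then have [simp]: "space \<mu> = UNIV"
    using sets_eq_imp_space_eq[OF sets] by simp
  have meas: "T \<in> measurable \<mu> borel"
    using borel_measurable_continuous_onI[OF cont] measurable_cong_sets[OF sets refl] by blast
  have "emeasure \<mu> (T -` U) > 0"
    using pos \<open>open U\<close> by (auto simp: emeasure_distr[OF meas] ennreal_zero_less_mult_iff)
  moreover have "open (T -` U)"
    using cont \<open>open U\<close> by (simp add: open_vimage)
  ultimately show ?thesis
    using open_meets_measure_supp[OF sets] by blast
qed

section \<open>Passage to the weak limit\<close>

text \<open>
  With \<open>y\<close> within \<open>r / 4\<close> of \<open>x\<close>, the ball of radius \<open>2 * R\<close> about \<open>x\<close> lies in that of radius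
  \<open>3 * R\<close> about \<open>y\<close>, while the ball of radius \<open>r / 4\<close> about \<open>y\<close> lies in that of radius \<open>r / 2\<close> about
  \<open>x\<close>. The quotient of the radii at \<open>y\<close> is \<open>12 * (R / r)\<close>, which explains the new constant; the gaps
  from \<open>R\<close> to \<open>2 * R\<close> and from \<open>r / 2\<close> to \<open>r\<close> leave room for the cutoff functions.
\<close>

lemma homogeneous_on_weak_limit:
  fixes \<mu>' :: "'a::heine_borel measure"
  assumes lf': "locally_finite_borel_measure \<mu>'"
    and lf: "\<And>k. locally_finite_borel_measure (\<nu> k)"
    and conv: "weakly_converges \<nu> \<mu>'"
    and charge: "\<And>k U. open U \<Longrightarrow> emeasure (\<nu> k) U > 0 \<Longrightarrow> U \<inter> A k \<noteq> {}"
    and hom: "\<And>k. homogeneous_on (A k) (\<nu> k) C s"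
    and "C > 0"
  shows "homogeneous_on (measure_supp \<mu>') \<mu>' (C * 12 powr s) s"
  unfolding homogeneous_on_def
proof (intro ballI allI impI)
  fix x and r R :: real
  assume x: "x \<in> measure_supp \<mu>'" and rR: "0 < r \<and> r < R"
  define K where "K = C * (3 * R / (r / 4)) powr s"
  have "K \<ge> 0"
    using \<open>C > 0\<close> by (simp add: K_def)
  have lim: "(\<lambda>k. \<integral>y. cutoff x a b y \<partial>\<nu> k) \<longlonglongrightarrow> (\<integral>y. cutoff x a b y \<partial>\<mu>')" if "a < b" for a b
    using conv continuous_cutoff[of x a b] compact_support_cutoff[OF that, of x]
    unfolding weakly_converges_def by blast
  \<comment> \<open>The mass near \<open>x\<close> is eventually positive, so a centre within \<open>r / 4\<close> of \<open>x\<close> exists eventually.\<close>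
  have "0 < (\<integral>y. cutoff x (r / 8) (r / 4) y \<partial>\<mu>')"
    using measure_ball_pos[OF lf' x, of "r / 8"] integral_cutoff_bounds(1)[OF lf', of "r / 8" "r / 4" x] rR
    by simp
  then have ev: "\<forall>\<^sub>F k in sequentially. 0 < (\<integral>y. cutoff x (r / 8) (r / 4) y \<partial>\<nu> k)"
    using rR by (intro order_tendstoD(1)[OF lim]) auto
  have "\<forall>\<^sub>F k in sequentially.
      (\<integral>y. cutoff x R (2 * R) y \<partial>\<nu> k) \<le> K * (\<integral>y. cutoff x (r / 2) r y \<partial>\<nu> k)"
    using ev
  proof eventually_elim
    case (elim k)
    have "0 < measure (\<nu> k) (ball x (r / 4))"
      using elim integral_cutoff_bounds(2)[OF lf, of "r / 8" "r / 4" k x] rR by simp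
    then have "emeasure (\<nu> k) (ball x (r / 4)) > 0"
      by (simp add: bounded_emeasure_eq_measure[OF lf bounded_ball])
    then obtain y where y: "y \<in> A k" "dist x y < r / 4"
      using charge[of "ball x (r / 4)" k] by auto
    have "(\<integral>y. cutoff x R (2 * R) y \<partial>\<nu> k) \<le> measure (\<nu> k) (ball x (2 * R))"
      using rR by (intro integral_cutoff_bounds(2) lf) auto
    also have "\<dots> \<le> measure (\<nu> k) (ball y (3 * R))"
    proof (rule measure_mono_bounded[OF lf])
      show "ball x (2 * R) \<subseteq> ball y (3 * R)"
      proof
        fix w assume "w \<in> ball x (2 * R)"
        then show "w \<in> ball y (3 * R)"
          using y(2) rR dist_triangle[of y w x] by (simp add: dist_commute)
      qed
    qed auto
    also have "\<dots> \<le> K * measure (\<nu> k) (ball y (r / 4))"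
      using hom[unfolded homogeneous_on_def, rule_format, OF y(1), of "r / 4" "3 * R"] rR
      by (simp add: K_def)
    also have "\<dots> \<le> K * measure (\<nu> k) (ball x (r / 2))"
    proof (intro mult_left_mono measure_mono_bounded[OF lf])
      show "ball y (r / 4) \<subseteq> ball x (r / 2)"
      proof
        fix w assume "w \<in> ball y (r / 4)"
        then show "w \<in> ball x (r / 2)"
          using y(2) dist_triangle[of x w y] by simp
      qed
    qed (use \<open>K \<ge> 0\<close> in auto)
    also have "\<dots> \<le> K * (\<integral>y. cutoff x (r / 2) r y \<partial>\<nu> k)"
      using rR \<open>K \<ge> 0\<close> by (intro mult_left_mono integral_cutoff_bounds(1) lf) auto
    finally show ?case .
  qed
  then have le: "(\<integral>y. cutoff x R (2 * R) y \<partial>\<mu>') \<le> K * (\<integral>y. cutoff x (r / 2) r y \<partial>\<mu>')"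
    using rR by (intro tendsto_le[OF sequentially_bot tendsto_mult_left[OF lim] lim]) auto
  have "measure \<mu>' (ball x R) \<le> (\<integral>y. cutoff x R (2 * R) y \<partial>\<mu>')"
    using rR by (intro integral_cutoff_bounds(1) lf') auto
  also note le
  also have "K * (\<integral>y. cutoff x (r / 2) r y \<partial>\<mu>') \<le> K * measure \<mu>' (ball x r)"
    using rR \<open>K \<ge> 0\<close> by (intro mult_left_mono integral_cutoff_bounds(2) lf') auto
  also have "K = C * 12 powr s * (R / r) powr s"
  proof -
    have "3 * R / (r / 4) = 12 * (R / r)"
      by simp
    then show ?thesis
      using rR by (simp only: K_def powr_mult mult.assoc)
  qed
  finally show "measure \<mu>' (ball x R) \<le> C * 12 powr s * (R / r) powr s * measure \<mu>' (ball x r)" .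
qed

theorem theorem2p2:
  fixes \<mu> \<mu>' :: "(real ^ 'd) measure"
  assumes "locally_finite_borel_measure \<mu>"
    and "weak_tangent_measure \<mu>' \<mu>"
  shows "upper_reg_dim \<mu>' \<le> upper_reg_dim \<mu>"
proof -
  from assms(2) obtain T p where
    lf': "locally_finite_borel_measure \<mu>'" and
    T: "\<And>k. similarity (T k)" and p: "\<And>k. p k > 0" and
    conv: "weakly_converges (\<lambda>k. scale_measure (ennreal (p k)) (distr \<mu> borel (T k))) \<mu>'"
    unfolding weak_tangent_measure_def by blast
  have dim: "upper_reg_dim \<nu> =
      (INF s \<in> {s. 0 \<le> s \<and> (\<exists>C>0. homogeneous_on (measure_supp \<nu>) \<nu> C s)}. ereal s)"
    if "locally_finite_borel_measure \<nu>" for \<nu> :: "(real ^ 'd) measure"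
    unfolding upper_reg_dim_def
    by (intro arg_cong[where f = "\<lambda>S. INF s \<in> S. ereal s"] Collect_cong conj_cong refl ex_cong1)
      (simp add: homogeneous_on_measure_supp_iff[OF that])
  have "homogeneous_on (measure_supp \<mu>') \<mu>' (C * 12 powr s) s"
    if "C > 0" "homogeneous_on (measure_supp \<mu>) \<mu> C s" for C s
    using lf' locally_finite_similar_image[OF assms(1) T] conv
      similar_image_charges[OF assms(1) T]
      homogeneous_on_similar_image[OF assms(1) T p that(2)] that(1)
    by (rule homogeneous_on_weak_limit)
  moreover have "C * 12 powr s > 0" if "C > 0" for C s :: real
    using that by simp
  ultimately show ?thesis
    unfolding dim[OF assms(1)] dim[OF lf'] by (intro INF_superset_mono) blast+
qed

end
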